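(* Let $T_n^{(0)},T_n^{(1)}\in\mathbb{C}^{(n+1)\times(n+1)}$ be tridiagonal matrices with $\det(T_n^{(0)}-zT_n^{(1)})\not\equiv0$, and for $B\in\mathbb{C}^{m\times m}$ put $T_n(B)=T_n^{(0)}\otimes I-T_n^{(1)}\otimes B$. Let $\tau_1,\ldots,\tau_{k_0}$ be the (finite) eigenvalues of the pencil $T_n^{(0)}-zT_n^{(1)}$ appearing in its Weierstrass canonical form, and let $n^{(1)}$ be the total size of the part of that form belonging to the eigenvalue infinity. Let $A,\widetilde A\in\mathbb{C}^{m\times m}$, where $\widetilde A$ is regarded as an approximation for $A$, and for any $\tau\in\mathbb{C}$ take $\widetilde A-\tau I$ as the approximation for $A-\tau I$. Assume that $T_n(\widetilde A)$ and the matrices $\widetilde A-\tau_iI$, $i=1,\dots,k_0$, are nonsingular. Let $$M(\tau)=I-(\widetilde A-\tau I)^{-1}(A-\tau I),\qquad M_{T_n}=I-T_n(\widetilde A)^{-1}T_n(A)$$ be the error propagators for the shifted matrices $A-\tau I$ and for the CF-matrix $T_n(A)$, respectively. Then $$\operatorname{spec}(M_{T_n})=\begin{cases}\bigcup_{i=1}^{k_0}\operatorname{spec}(M(\tau_i))&\text{if }n^{(1)}=0,\\ \bigcup_{i=1}^{k_0}\operatorname{spec}(M(\tau_i))\cup\{0\}&\text{if }n^{(1)}>0.\end{cases}$$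
   Context: $\otimes$ is the Kronecker product. The Weierstrass canonical form of the regular pencil $T_n^{(0)}-zT_n^{(1)}$ is $$U(T_n^{(0)}-zT_n^{(1)})V=\begin{bmatrix}J^{(0)}-zI_{n^{(0)}}\\&I_{n^{(1)}}-zJ^{(1)}\end{bmatrix},\quad J^{(0)}=\bigoplus_{j=1}^{k_0}J(\tau_j,n_j^{(0)}),\quad J^{(1)}=\bigoplus_{j=1}^{k_1}J(0,n_j^{(1)}),$$ with $U,V$ nonsingular, $J(\mu,m)$ the $m\times m$ Jordan block with eigenvalue $\mu$, $n^{(i)}=\sum_{j=1}^{k_i}n_j^{(i)}$, $n^{(0)}+n^{(1)}=n+1$. The error propagator of a splitting iteration $x_{i+1}=x_i+\widetilde B^{-1}(b-Bx_i)$ for $Bx=b$ is $I-\widetilde B^{-1}B$. In the paper, $T_n(A)$ is called the CF-matrix (continued fraction matrix). *)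

theory Defs
  imports "Jordan_Normal_Form.Spectral_Radius"
begin

definition tridiagonal_mat :: "'a :: zero mat \<Rightarrow> bool" where
  "tridiagonal_mat A \<longleftrightarrow>
     (\<forall>i < dim_row A. \<forall>j < dim_col A. i + 1 < j \<or> j + 1 < i \<longrightarrow> A $$ (i, j) = 0)"

definition kronecker_prod :: "'a :: times mat \<Rightarrow> 'a mat \<Rightarrow> 'a mat" (infixl "\<otimes>\<^sub>K" 72) where
  "A \<otimes>\<^sub>K B = mat (dim_row A * dim_row B) (dim_col A * dim_col B)
     (\<lambda>(i, j). A $$ (i div dim_row B, j div dim_col B) * B $$ (i mod dim_row B, j mod dim_col B))"

definition regular_pencil :: "complex mat \<Rightarrow> complex mat \<Rightarrow> bool" where
  "regular_pencil T0 T1 \<longleftrightarrow> (\<exists>z. det (T0 - z \<cdot>\<^sub>m T1) \<noteq> 0)"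

definition cf_matrix :: "complex mat \<Rightarrow> complex mat \<Rightarrow> complex mat \<Rightarrow> complex mat" where
  "cf_matrix T0 T1 B = T0 \<otimes>\<^sub>K 1\<^sub>m (dim_row B) - T1 \<otimes>\<^sub>K B"

text \<open>
  The Weierstrass canonical form of the \<open>N \<times> N\<close> pencil \<open>T0 - z T1\<close>. The blocks of the finite part
  are listed in \<open>bs0\<close> as pairs (size, eigenvalue), as in \<^const>\<open>jordan_nf\<close>; \<open>bs1\<close> lists the
  sizes of the nilpotent blocks belonging to the eigenvalue infinity. Blocks have positive size, so
  that every eigenvalue listed in \<open>bs0\<close> actually occurs; either list may be empty.
\<close>
definition weierstrass_form ::
  "nat \<Rightarrow> complex mat \<Rightarrow> complex mat \<Rightarrow> complex mat \<Rightarrow> complex mat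
     \<Rightarrow> (nat \<times> complex) list \<Rightarrow> nat list \<Rightarrow> bool" where
  "weierstrass_form N T0 T1 U V bs0 bs1 \<longleftrightarrow>
     U \<in> carrier_mat N N \<and> V \<in> carrier_mat N N \<and> invertible_mat U \<and> invertible_mat V \<and>
     0 \<notin> fst ` set bs0 \<and> 0 \<notin> set bs1 \<and>
     sum_list (map fst bs0) + sum_list bs1 = N \<and>
     (let n0 = sum_list (map fst bs0); n1 = sum_list bs1;
          J0 = jordan_matrix bs0; J1 = jordan_matrix (map (\<lambda>k. (k, 0)) bs1)
      in \<forall>z. U * (T0 - z \<cdot>\<^sub>m T1) * V =
           four_block_mat (J0 - z \<cdot>\<^sub>m 1\<^sub>m n0) (0\<^sub>m n0 n1) (0\<^sub>m n1 n0) (1\<^sub>m n1 - z \<cdot>\<^sub>m J1))"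

text \<open>
  The error propagator \<open>I - Bt\<^sup>-\<^sup>1 B\<close> of the splitting iteration for \<open>B x = b\<close> with approximation
  \<open>Bt\<close> of \<open>B\<close>; it is meaningful only for nonsingular \<open>Bt\<close>, where \<^const>\<open>mat_inverse\<close> is not
  \<^const>\<open>None\<close>.
\<close>
definition error_propagator :: "complex mat \<Rightarrow> complex mat \<Rightarrow> complex mat" where
  "error_propagator Bt B = 1\<^sub>m (dim_row B) - the (mat_inverse Bt) * B"

end

theory Submission
  imports Defs
begin

text \<open>
  Everything reduces to determinants. Since \<open>Bt\<close> is nonsingular, \<open>c\<close> is an eigenvalue of
  \<open>I - Bt\<^sup>-\<^sup>1 B\<close> iff \<open>(1 - c) Bt - B\<close> is singular (\<open>spectrum_error_propagator\<close>); no inverse is left.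
  For the CF-matrix this combination is again a difference of two Kronecker products
  (\<open>cf_matrix_combination\<close>):
  \<open>(1 - c) T(At) - T(A) = T0 \<otimes> C - T1 \<otimes> D\<close> with \<open>C = - c I\<close> and \<open>D = (1 - c) At - A\<close>.

  Multiplication by \<open>U \<otimes> I\<close> and \<open>V \<otimes> I\<close>, which are nonsingular, replaces \<open>T0\<close> and \<open>T1\<close> by the two
  matrices of the Weierstrass form, because \<open>(U \<otimes> I) (T \<otimes> C) (V \<otimes> I) = (U T V) \<otimes> C\<close>. These two
  matrices are upper triangular, so the Kronecker pencil becomes block upper triangular and its
  determinant is the product of the determinants of its diagonal blocks
  (\<open>det_kronecker_weierstrass\<close>). A diagonal position with finite eigenvalue \<open>\<tau>\<close> contributes
  \<open>det (\<tau> C - D)\<close>, and the matrix \<open>\<tau> C - D = - ((1 - c) (At - \<tau> I) - (A - \<tau> I))\<close>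
  is singular iff \<open>c\<close> is in the spectrum of \<open>M(\<tau>)\<close>, by the same reduction as above. A
  position belonging to the eigenvalue infinity contributes \<open>det C = (- c)\<^sup>m\<close>, hence the extra
  eigenvalue 0 exactly when such positions exist.
\<close>

section \<open>The Kronecker product\<close>

lemma kronecker_prod_carrier [simp]:
  "A \<in> carrier_mat a b \<Longrightarrow> B \<in> carrier_mat c d \<Longrightarrow> A \<otimes>\<^sub>K B \<in> carrier_mat (a * c) (b * d)"
  by (auto simp: kronecker_prod_def)

lemma div_mod_less_mult:
  fixes i m n :: nat
  assumes "i < n * m"
  shows "i div m < n" and "i mod m < m"
  using assms by (auto simp: less_mult_imp_div_less intro!: mod_less_divisor gr0I)

lemma kronecker_prod_index:
  assumes "A \<in> carrier_mat a b" and "B \<in> carrier_mat c d" and "i < a * c" and "j < b * d"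
  shows "(A \<otimes>\<^sub>K B) $$ (i, j) = A $$ (i div c, j div d) * B $$ (i mod c, j mod d)"
  using assms by (auto simp: kronecker_prod_def)

text \<open>
  Kronecker products index pairs \<open>(a, b)\<close> by \<open>a * m + b\<close>; this turns the single sum in a matrix
  product of Kronecker products into a double sum that factors.
\<close>
lemma sum_div_mod:
  fixes f :: "nat \<Rightarrow> nat \<Rightarrow> 'a :: comm_monoid_add"
  shows "(\<Sum>k<n * m. f (k div m) (k mod m)) = (\<Sum>a<n. \<Sum>b<m. f a b)"
proof -
  have "(\<Sum>k = a * m..<a * m + m. f (k div m) (k mod m)) = (\<Sum>b<m. f a b)" for a
  proof -
    have "(\<Sum>k = a * m..<a * m + m. f (k div m) (k mod m))
        = (\<Sum>k = 0 + a * m..<m + a * m. f (k div m) (k mod m))"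
      by (simp add: add.commute)
    also have "\<dots> = (\<Sum>b = 0..<m. f ((b + a * m) div m) ((b + a * m) mod m))"
      by (rule sum.shift_bounds_nat_ivl)
    also have "\<dots> = (\<Sum>b<m. f a b)"
      by (rule sum.cong) auto
    finally show ?thesis .
  qed
  then show ?thesis
    by (simp flip: sum.nat_group)
qed

text \<open>
  The mixed product property: once the inner summation index is split into quotient and remainder,
  the double sum is a product of an entry of \<open>A * C\<close> and an entry of \<open>B * D\<close>.
\<close>
lemma kronecker_prod_mult:
  fixes A :: "'a :: comm_semiring_0 mat"
  assumes A: "A \<in> carrier_mat a b" and C: "C \<in> carrier_mat b e"
    and B: "B \<in> carrier_mat c d" and D: "D \<in> carrier_mat d f"
  shows "(A \<otimes>\<^sub>K B) * (C \<otimes>\<^sub>K D) = (A * C) \<otimes>\<^sub>K (B * D)"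
proof (rule eq_matI)
  fix i j
  assume "i < dim_row ((A * C) \<otimes>\<^sub>K (B * D))" "j < dim_col ((A * C) \<otimes>\<^sub>K (B * D))"
  then have i: "i < a * c" and j: "j < e * f"
    using assms by (auto simp: kronecker_prod_def)
  note ij = div_mod_less_mult[OF i] div_mod_less_mult[OF j]
  have "((A \<otimes>\<^sub>K B) * (C \<otimes>\<^sub>K D)) $$ (i, j)
      = (\<Sum>k<b * d. (A \<otimes>\<^sub>K B) $$ (i, k) * (C \<otimes>\<^sub>K D) $$ (k, j))"
    using i j kronecker_prod_carrier[OF A B] kronecker_prod_carrier[OF C D]
    by (auto simp: scalar_prod_def lessThan_atLeast0)
  also have "\<dots> = (\<Sum>k<b * d. A $$ (i div c, k div d) * B $$ (i mod c, k mod d)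
      * (C $$ (k div d, j div f) * D $$ (k mod d, j mod f)))"
    using i j by (intro sum.cong) (auto simp: kronecker_prod_index[OF A B] kronecker_prod_index[OF C D])
  also have "\<dots> = (\<Sum>k<b. \<Sum>l<d. A $$ (i div c, k) * B $$ (i mod c, l)
      * (C $$ (k, j div f) * D $$ (l, j mod f)))"
    by (rule sum_div_mod)
  also have "\<dots> = (\<Sum>k<b. A $$ (i div c, k) * C $$ (k, j div f))
      * (\<Sum>l<d. B $$ (i mod c, l) * D $$ (l, j mod f))"
    by (simp add: sum_product mult_ac)
  also have "\<dots> = (A * C) $$ (i div c, j div f) * (B * D) $$ (i mod c, j mod f)"
    using assms ij by (auto simp: scalar_prod_def lessThan_atLeast0)
  also have "\<dots> = ((A * C) \<otimes>\<^sub>K (B * D)) $$ (i, j)"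
    using i j by (subst kronecker_prod_index[of _ a e _ c f]) (use assms in auto)
  finally show "((A \<otimes>\<^sub>K B) * (C \<otimes>\<^sub>K D)) $$ (i, j) = ((A * C) \<otimes>\<^sub>K (B * D)) $$ (i, j)" .
qed (use assms in \<open>auto simp: kronecker_prod_def\<close>)

lemma kronecker_prod_one:
  "1\<^sub>m n \<otimes>\<^sub>K 1\<^sub>m m = (1\<^sub>m (n * m) :: 'a :: semiring_1 mat)"
proof (rule eq_matI)
  fix i j
  assume "i < dim_row (1\<^sub>m (n * m) :: 'a mat)" "j < dim_col (1\<^sub>m (n * m) :: 'a mat)"
  then have i: "i < n * m" and j: "j < n * m" by auto
  have "i = j \<longleftrightarrow> i div m = j div m \<and> i mod m = j mod m"
    by (metis div_mult_mod_eq)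
  then show "((1\<^sub>m n \<otimes>\<^sub>K 1\<^sub>m m) :: 'a mat) $$ (i, j) = 1\<^sub>m (n * m) $$ (i, j)"
    using i j div_mod_less_mult[OF i] div_mod_less_mult[OF j]
    by (auto simp: kronecker_prod_index[of _ n n _ m m])
qed (auto simp: kronecker_prod_def)

section \<open>Invertible factors\<close>

text \<open>
  The predicate \<^const>\<open>invertible_mat\<close> does not give the dimensions of the inverse; they follow by
  comparing the dimensions of the two products with those of the identity matrices.
\<close>
lemma invertible_matE:
  assumes "invertible_mat A" and "A \<in> carrier_mat n n"
  obtains B where "B \<in> carrier_mat n n" and "A * B = 1\<^sub>m n" and "B * A = 1\<^sub>m n"
proof -
  from assms obtain B where AB: "A * B = 1\<^sub>m n" and BA: "B * A = 1\<^sub>m (dim_row B)"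
    by (auto simp: invertible_mat_def inverts_mat_def)
  have "dim_col (A * B) = n" "dim_col (B * A) = dim_row B"
    using AB BA by simp_all
  then have "B \<in> carrier_mat n n" 
    using assms(2) by auto
  with AB BA that show thesis by auto
qed

lemma invertible_mat_det_nonzero:
  fixes A :: "'a :: idom mat"
  assumes "invertible_mat A" and "A \<in> carrier_mat n n"
  shows "det A \<noteq> 0"
proof -
  obtain B where "B \<in> carrier_mat n n" "A * B = 1\<^sub>m n"
    using assms by (rule invertible_matE)
  with det_mult[OF assms(2), of B] show ?thesis by auto
qed

text \<open>
  If \<open>B\<close> inverts \<open>U\<close>, then \<open>B \<otimes> I\<close> inverts \<open>U \<otimes> I\<close> by the mixed product property.
\<close>
lemma det_kronecker_prod_one_nonzero:
  fixes U :: "'a :: idom mat"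
  assumes "invertible_mat U" and U: "U \<in> carrier_mat n n"
  shows "det (U \<otimes>\<^sub>K 1\<^sub>m m) \<noteq> 0"
proof -
  obtain B where B: "B \<in> carrier_mat n n" "U * B = 1\<^sub>m n"
    using assms by (rule invertible_matE)
  have "(U \<otimes>\<^sub>K 1\<^sub>m m) * (B \<otimes>\<^sub>K 1\<^sub>m m) = 1\<^sub>m (n * m)"
    using U B by (simp add: kronecker_prod_mult[of _ n n _ n _ m m _ m] kronecker_prod_one)
  with det_mult[of "U \<otimes>\<^sub>K 1\<^sub>m m" "n * m" "B \<otimes>\<^sub>K 1\<^sub>m m"] U B show ?thesis by auto
qed

section \<open>Determinants of block upper triangular matrices\<close>

text \<open>
  The last block row is zero except in its last block. Splitting it off, rather than the first
  one, leaves the indices of the remaining blocks unshifted in the induction.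
\<close>
lemma det_block_upper_triangular:
  fixes X :: "'a :: idom mat"
  assumes "X \<in> carrier_mat (n * m) (n * m)"
    and "\<And>i j. i < n * m \<Longrightarrow> j < n * m \<Longrightarrow> j div m < i div m \<Longrightarrow> X $$ (i, j) = 0"
  shows "det X = (\<Prod>k<n. det (mat m m (\<lambda>(i, j). X $$ (k * m + i, k * m + j))))"
  using assms
proof (induction n arbitrary: X)
  case 0
  then show ?case by simp
next
  case (Suc n)
  let ?X1 = "mat (n * m) (n * m) (\<lambda>(i, j). X $$ (i, j))"
  let ?X2 = "mat (n * m) m (\<lambda>(i, j). X $$ (i, n * m + j))"
  let ?X4 = "mat m m (\<lambda>(i, j). X $$ (n * m + i, n * m + j))"
  have below: "X $$ (i, j) = 0" if "n * m \<le> i" "i < Suc n * m" "j < n * m" for i j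
  proof (rule Suc.prems(2))
    have "0 < m" using that by (auto intro: gr0I)
    then have "n \<le> i div m" using that by (simp add: less_eq_div_iff_mult_less_eq)
    with that show "j div m < i div m" by (meson div_mod_less_mult(1) less_le_trans)
  qed (use that in auto)
  have X: "X = four_block_mat ?X1 ?X2 (0\<^sub>m m (n * m)) ?X4"
  proof (rule eq_matI, goal_cases)
    case (1 i j)
    then have "i < Suc n * m" "j < Suc n * m" by (auto simp: algebra_simps)
    then show ?case using below[of i j] 1 by (auto simp: algebra_simps)
  qed (use Suc.prems(1) in auto)
  have "det ?X1 = (\<Prod>k<n. det (mat m m (\<lambda>(i, j). ?X1 $$ (k * m + i, k * m + j))))"
    by (rule Suc.IH) (use Suc.prems(2) in \<open>auto simp: trans_less_add2\<close>)
  also have "\<dots> = (\<Prod>k<n. det (mat m m (\<lambda>(i, j). X $$ (k * m + i, k * m + j))))"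
  proof (intro prod.cong arg_cong[of _ _ det] cong_mat)
    fix k i j
    assume "k \<in> {..<n}" "i < m" "j < m"
    then have "Suc k * m \<le> n * m" by (intro mult_le_mono1) auto
    then show "(\<lambda>(i, j). ?X1 $$ (k * m + i, k * m + j)) (i, j) = (\<lambda>(i, j). X $$ (k * m + i, k * m + j)) (i, j)"
      using \<open>i < m\<close> \<open>j < m\<close> by auto
  qed auto
  finally have "det ?X1 = (\<Prod>k<n. det (mat m m (\<lambda>(i, j). X $$ (k * m + i, k * m + j))))" .
  moreover have "det X = det ?X1 * det ?X4"
    by (subst X, rule det_four_block_mat_lower_left_zero) auto
  ultimately show ?case by simp
qed

text \<open>
  Block \<open>(k, l)\<close> of \<open>P \<otimes> C - Q \<otimes> D\<close> is \<open>P\<^bsub>kl\<^esub> C - Q\<^bsub>kl\<^esub> D\<close>, so triangularity of \<open>P\<close> and \<open>Q\<close>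
  becomes block triangularity.
\<close>
lemma det_kronecker_pencil_upper_triangular:
  fixes P Q C D :: "'a :: idom mat"
  assumes P: "P \<in> carrier_mat n n" "upper_triangular P" and Q: "Q \<in> carrier_mat n n" "upper_triangular Q"
    and C: "C \<in> carrier_mat m m" and D: "D \<in> carrier_mat m m"
  shows "det (P \<otimes>\<^sub>K C - Q \<otimes>\<^sub>K D) = (\<Prod>k<n. det (P $$ (k, k) \<cdot>\<^sub>m C - Q $$ (k, k) \<cdot>\<^sub>m D))"
proof -
  let ?X = "P \<otimes>\<^sub>K C - Q \<otimes>\<^sub>K D"
  have X: "?X \<in> carrier_mat (n * m) (n * m)" 
    using kronecker_prod_carrier[OF P(1) C] kronecker_prod_carrier[OF Q(1) D] by auto
  have index: "?X $$ (i, j) = P $$ (i div m, j div m) * C $$ (i mod m, j mod m)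
      - Q $$ (i div m, j div m) * D $$ (i mod m, j mod m)" if "i < n * m" "j < n * m" for i j
    using that kronecker_prod_carrier[OF Q(1) D]
    by (simp add: kronecker_prod_index[OF P(1) C] kronecker_prod_index[OF Q(1) D] carrier_matD)
  have "?X $$ (i, j) = 0" if ij: "i < n * m" "j < n * m" "j div m < i div m" for i j
    using that div_mod_less_mult[OF that(1)] P Q
    by (simp add: index upper_triangularD)
  then have "det ?X = (\<Prod>k<n. det (mat m m (\<lambda>(i, j). ?X $$ (k * m + i, k * m + j))))"
    by (rule det_block_upper_triangular[OF X])
  also have "\<dots> = (\<Prod>k<n. det (P $$ (k, k) \<cdot>\<^sub>m C - Q $$ (k, k) \<cdot>\<^sub>m D))"
  proof (intro prod.cong refl arg_cong[of _ _ det] eq_matI)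
    fix k i j
    assume k: "k \<in> {..<n}" and "i < dim_row (P $$ (k, k) \<cdot>\<^sub>m C - Q $$ (k, k) \<cdot>\<^sub>m D)"
      "j < dim_col (P $$ (k, k) \<cdot>\<^sub>m C - Q $$ (k, k) \<cdot>\<^sub>m D)"
    then have ij: "i < m" "j < m" using C D by auto
    have "Suc k * m \<le> n * m" using k by (intro mult_le_mono1) auto
    then have "k * m + i < n * m" "k * m + j < n * m" using ij by auto
    then show "mat m m (\<lambda>(i, j). ?X $$ (k * m + i, k * m + j)) $$ (i, j)
        = (P $$ (k, k) \<cdot>\<^sub>m C - Q $$ (k, k) \<cdot>\<^sub>m D) $$ (i, j)"
      using ij C D by (simp add: index)
  qed (use C D in auto)
  finally show ?thesis .
qed

section \<open>The Weierstrass form\<close>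

text \<open>
  Blocks of size zero have to be excluded, since their eigenvalue may be listed without occurring on the
  diagonal.
\<close>
lemma set_diag_jordan_matrix:
  "0 \<notin> fst ` set bs \<Longrightarrow> set (diag_mat (jordan_matrix bs)) = snd ` set bs"
proof (induction bs)
  case Nil
  then show ?case by (simp add: diag_mat_def)
next
  case (Cons b bs)
  obtain k a where b: "b = (k, a)" by force
  have "set (diag_mat (jordan_block k a)) = {a}"
    using Cons.prems b by (auto simp: diag_mat_def)
  then show ?case using Cons b
    by (simp add: jordan_matrix_Cons diag_four_block_mat[OF jordan_block_carrier jordan_matrix_carrier])
qed

text \<open>
  A pencil determines its coefficients: its values at \<open>z = 0\<close> and \<open>z = 1\<close> suffice.
\<close>
lemma pencil_eqD:
  fixes X0 X1 Y0 Y1 :: "'a :: comm_ring_1 mat"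
  assumes X: "X0 \<in> carrier_mat r s" "X1 \<in> carrier_mat r s"
    and Y: "Y0 \<in> carrier_mat r s" "Y1 \<in> carrier_mat r s"
    and eq: "\<And>z. X0 - z \<cdot>\<^sub>m X1 = Y0 - z \<cdot>\<^sub>m Y1"
  shows "X0 = Y0" and "X1 = Y1"
proof -
  have entry: "X0 $$ (i, j) - z * X1 $$ (i, j) = Y0 $$ (i, j) - z * Y1 $$ (i, j)"
    if "i < r" "j < s" for i j z
    using arg_cong[OF eq[of z], of "\<lambda>M. M $$ (i, j)"] that X Y by simp
  have "X0 $$ (i, j) = Y0 $$ (i, j) \<and> X1 $$ (i, j) = Y1 $$ (i, j)" if "i < r" "j < s" for i j
    using entry[OF that, of 0] entry[OF that, of 1] by simp
  with X Y show "X0 = Y0" and "X1 = Y1"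
    by (simp_all add: mat_eq_iff)
qed

text \<open>
  The Weierstrass form is stated for the pencil as a function of \<open>z\<close>. The Kronecker argument has
  a matrix in the place of the scalar \<open>z\<close>, so it needs the form of the two coefficients separately.
\<close>
lemma weierstrass_formD:
  assumes "weierstrass_form N T0 T1 U V bs0 bs1"
    and T0: "T0 \<in> carrier_mat N N" and T1: "T1 \<in> carrier_mat N N"
  defines "n0 \<equiv> sum_list (map fst bs0)" and "n1 \<equiv> sum_list bs1"
  shows "U * T0 * V = four_block_mat (jordan_matrix bs0) (0\<^sub>m n0 n1) (0\<^sub>m n1 n0) (1\<^sub>m n1)"
    and "U * T1 * V = four_block_mat (1\<^sub>m n0) (0\<^sub>m n0 n1) (0\<^sub>m n1 n0)
      (jordan_matrix (map (\<lambda>k. (k, 0)) bs1))"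
proof -
  define J0 J1 where J_defs: "J0 = jordan_matrix bs0" "J1 = jordan_matrix (map (\<lambda>k. (k, 0 :: complex)) bs1)"
  let ?P = "four_block_mat J0 (0\<^sub>m n0 n1) (0\<^sub>m n1 n0) (1\<^sub>m n1)"
  let ?Q = "four_block_mat (1\<^sub>m n0) (0\<^sub>m n0 n1) (0\<^sub>m n1 n0) J1"
  have U: "U \<in> carrier_mat N N" and V: "V \<in> carrier_mat N N" and N: "n0 + n1 = N"
    and wf: "\<And>z. U * (T0 - z \<cdot>\<^sub>m T1) * V =
      four_block_mat (J0 - z \<cdot>\<^sub>m 1\<^sub>m n0) (0\<^sub>m n0 n1) (0\<^sub>m n1 n0) (1\<^sub>m n1 - z \<cdot>\<^sub>m J1)"
    using assms(1) unfolding weierstrass_form_def Let_def n0_def n1_def J_defs by auto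
  have J0: "J0 \<in> carrier_mat n0 n0" and J1: "J1 \<in> carrier_mat n1 n1"
    using jordan_matrix_carrier[of bs0] jordan_matrix_carrier[of "map (\<lambda>k. (k, 0 :: complex)) bs1"]
    by (simp_all add: n0_def n1_def J_defs o_def)
  have lin: "U * (T0 - z \<cdot>\<^sub>m T1) * V = U * T0 * V - z \<cdot>\<^sub>m (U * T1 * V)" for z
  proof -
    have "U * (T0 - z \<cdot>\<^sub>m T1) * V = (U * T0 - U * (z \<cdot>\<^sub>m T1)) * V"
      using U T0 T1 by (subst mult_minus_distrib_mat) auto
    also have "\<dots> = U * T0 * V - U * (z \<cdot>\<^sub>m T1) * V"
      using U V T0 T1 by (intro minus_mult_distrib_mat) auto
    also have "U * (z \<cdot>\<^sub>m T1) * V = z \<cdot>\<^sub>m (U * T1 * V)"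
      using U V T1 by (simp add: mult_smult_distrib[of U N N] mult_smult_assoc_mat[of _ N N])
    finally show ?thesis .
  qed
  have PQ: "four_block_mat (J0 - z \<cdot>\<^sub>m 1\<^sub>m n0) (0\<^sub>m n0 n1) (0\<^sub>m n1 n0) (1\<^sub>m n1 - z \<cdot>\<^sub>m J1)
      = ?P - z \<cdot>\<^sub>m ?Q" for z
    by (rule eq_matI) (use J0 J1 in auto)
  have eq: "U * T0 * V - z \<cdot>\<^sub>m (U * T1 * V) = ?P - z \<cdot>\<^sub>m ?Q" for z
    using wf[of z] by (simp only: lin PQ)
  have car: "U * T0 * V \<in> carrier_mat N N" "U * T1 * V \<in> carrier_mat N N"
    "?P \<in> carrier_mat N N" "?Q \<in> carrier_mat N N"
    using U V T0 T1 J0 J1 N by auto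
  from pencil_eqD[OF car eq] show "U * T0 * V = four_block_mat (jordan_matrix bs0) (0\<^sub>m n0 n1) (0\<^sub>m n1 n0) (1\<^sub>m n1)"
    and "U * T1 * V = four_block_mat (1\<^sub>m n0) (0\<^sub>m n0 n1) (0\<^sub>m n1 n0)
      (jordan_matrix (map (\<lambda>k. (k, 0)) bs1))"
    unfolding J_defs by simp_all
qed

text \<open>
  After the transformation by \<open>U \<otimes> I\<close> and \<open>V \<otimes> I\<close> the diagonal pairs of the pencil are \<open>(\<tau>, 1)\<close> in the
  finite part and \<open>(1, 0)\<close> in the nilpotent part; they give the diagonal blocks \<open>\<tau> C - D\<close> and \<open>C\<close>.
\<close>
lemma det_kronecker_weierstrass:
  fixes C D :: "complex mat"
  assumes wf: "weierstrass_form N T0 T1 U V bs0 bs1"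
    and T0: "T0 \<in> carrier_mat N N" and T1: "T1 \<in> carrier_mat N N"
    and C: "C \<in> carrier_mat m m" and D: "D \<in> carrier_mat m m"
  shows "det (T0 \<otimes>\<^sub>K C - T1 \<otimes>\<^sub>K D) = 0 \<longleftrightarrow>
    (\<exists>\<tau> \<in> snd ` set bs0. det (\<tau> \<cdot>\<^sub>m C - D) = 0) \<or> (sum_list bs1 \<noteq> 0 \<and> det C = 0)"
proof -
  define n0 n1 where "n0 = sum_list (map fst bs0)" and "n1 = sum_list bs1"
  define J0 J1 where "J0 = jordan_matrix bs0" and "J1 = jordan_matrix (map (\<lambda>k. (k, 0 :: complex)) bs1)"
  define P Q where "P = four_block_mat J0 (0\<^sub>m n0 n1) (0\<^sub>m n1 n0) (1\<^sub>m n1)"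
    and "Q = four_block_mat (1\<^sub>m n0) (0\<^sub>m n0 n1) (0\<^sub>m n1 n0) J1"
  have U: "U \<in> carrier_mat N N" "invertible_mat U" and V: "V \<in> carrier_mat N N" "invertible_mat V"
    and N: "N = n0 + n1" and pos: "0 \<notin> fst ` set bs0" "0 \<notin> set bs1"
    using wf unfolding weierstrass_form_def Let_def n0_def n1_def by auto
  have UTV: "U * T0 * V = P" "U * T1 * V = Q"
    using weierstrass_formD[OF wf T0 T1] unfolding P_def Q_def J0_def J1_def n0_def n1_def by auto
  have J0: "J0 \<in> carrier_mat n0 n0" "upper_triangular J0"
    unfolding J0_def n0_def by (auto intro!: jordan_matrix_upper_triangular)
  have J1: "J1 \<in> carrier_mat n1 n1" "upper_triangular J1"
    using jordan_matrix_carrier[of "map (\<lambda>k. (k, 0 :: complex)) bs1"]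
    unfolding J1_def n1_def by (auto intro!: jordan_matrix_upper_triangular simp: o_def)
  have P: "P \<in> carrier_mat N N" "upper_triangular P"
    unfolding P_def N using J0 by (auto intro!: upper_triangular_four_block)
  have Q: "Q \<in> carrier_mat N N" "upper_triangular Q"
    unfolding Q_def N using J1 by (auto intro!: upper_triangular_four_block)
  have "{J0 $$ (k, k) | k. k < n0} = set (diag_mat J0)"
    using J0(1) by (auto simp: diag_mat_def)
  then have diag0: "{J0 $$ (k, k) | k. k < n0} = snd ` set bs0"
    unfolding J0_def set_diag_jordan_matrix[OF pos(1)] .
  have "set (diag_mat J1) = (\<lambda>_. 0) ` set bs1"
    unfolding J1_def by (subst set_diag_jordan_matrix) (use pos(2) in \<open>auto simp: image_image\<close>)
  then have diag1: "J1 $$ (k, k) = 0" if "k < n1" for k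
    using that J1(1) by (auto simp: diag_mat_def)
  have ex_less_add: "(\<exists>k<n0 + n1. R k) \<longleftrightarrow> (\<exists>k<n0. R k) \<or> (\<exists>k<n1. R (n0 + k))" for R
  proof -
    have "k < n0 + n1 \<longleftrightarrow> k < n0 \<or> (\<exists>l<n1. k = n0 + l)" for k
      by presburger
    then show ?thesis by blast
  qed
  let ?I = "1\<^sub>m m :: complex mat"
  have kron: "(U \<otimes>\<^sub>K ?I) * (T \<otimes>\<^sub>K E) * (V \<otimes>\<^sub>K ?I) = (U * T * V) \<otimes>\<^sub>K E"
    if "T \<in> carrier_mat N N" "E \<in> carrier_mat m m" for T E
    using that U V
    by (simp add: kronecker_prod_mult[of _ N N _ N _ m m _ m])
  have carU: "U \<otimes>\<^sub>K ?I \<in> carrier_mat (N * m) (N * m)" and carV: "V \<otimes>\<^sub>K ?I \<in> carrier_mat (N * m) (N * m)"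
    and car0: "T0 \<otimes>\<^sub>K C \<in> carrier_mat (N * m) (N * m)" and car1: "T1 \<otimes>\<^sub>K D \<in> carrier_mat (N * m) (N * m)"
    using U V T0 T1 C D by auto
  have "(U \<otimes>\<^sub>K ?I) * (T0 \<otimes>\<^sub>K C - T1 \<otimes>\<^sub>K D) * (V \<otimes>\<^sub>K ?I)
      = (U \<otimes>\<^sub>K ?I) * (T0 \<otimes>\<^sub>K C) * (V \<otimes>\<^sub>K ?I) - (U \<otimes>\<^sub>K ?I) * (T1 \<otimes>\<^sub>K D) * (V \<otimes>\<^sub>K ?I)"
    using carU carV car0 car1
    by (subst mult_minus_distrib_mat[OF carU car0 car1])
      (rule minus_mult_distrib_mat, auto)
  also have "\<dots> = P \<otimes>\<^sub>K C - Q \<otimes>\<^sub>K D"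
    using kron[OF T0 C] kron[OF T1 D] UTV by simp
  finally have "det ((U \<otimes>\<^sub>K ?I) * (T0 \<otimes>\<^sub>K C - T1 \<otimes>\<^sub>K D) * (V \<otimes>\<^sub>K ?I)) = det (P \<otimes>\<^sub>K C - Q \<otimes>\<^sub>K D)"
    by simp
  moreover have "det ((U \<otimes>\<^sub>K ?I) * (T0 \<otimes>\<^sub>K C - T1 \<otimes>\<^sub>K D) * (V \<otimes>\<^sub>K ?I))
      = det (U \<otimes>\<^sub>K ?I) * det (T0 \<otimes>\<^sub>K C - T1 \<otimes>\<^sub>K D) * det (V \<otimes>\<^sub>K ?I)"
  proof -
    have "T0 \<otimes>\<^sub>K C - T1 \<otimes>\<^sub>K D \<in> carrier_mat (N * m) (N * m)"
      using car1 by (rule minus_carrier_mat)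
    with carU carV show ?thesis
      by (simp only: det_mult[OF mult_carrier_mat[OF carU _] carV] det_mult[OF carU])
  qed
  ultimately have "det (T0 \<otimes>\<^sub>K C - T1 \<otimes>\<^sub>K D) = 0 \<longleftrightarrow> det (P \<otimes>\<^sub>K C - Q \<otimes>\<^sub>K D) = 0"
    using det_kronecker_prod_one_nonzero[OF U(2,1)] det_kronecker_prod_one_nonzero[OF V(2,1)]
    by (metis mult_eq_0_iff)
  also have "\<dots> \<longleftrightarrow> (\<exists>k<n0 + n1. det (P $$ (k, k) \<cdot>\<^sub>m C - Q $$ (k, k) \<cdot>\<^sub>m D) = 0)"
    by (auto simp: det_kronecker_pencil_upper_triangular[OF P Q C D] N)
  also have "\<dots> \<longleftrightarrow> (\<exists>k<n0. det (P $$ (k, k) \<cdot>\<^sub>m C - Q $$ (k, k) \<cdot>\<^sub>m D) = 0)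
      \<or> (\<exists>k<n1. det (P $$ (n0 + k, n0 + k) \<cdot>\<^sub>m C - Q $$ (n0 + k, n0 + k) \<cdot>\<^sub>m D) = 0)"
    by (rule ex_less_add)
  also have "(\<exists>k<n0. det (P $$ (k, k) \<cdot>\<^sub>m C - Q $$ (k, k) \<cdot>\<^sub>m D) = 0)
      \<longleftrightarrow> (\<exists>k<n0. det (J0 $$ (k, k) \<cdot>\<^sub>m C - D) = 0)"
  proof -
    have "P $$ (k, k) \<cdot>\<^sub>m C - Q $$ (k, k) \<cdot>\<^sub>m D = J0 $$ (k, k) \<cdot>\<^sub>m C - D" if "k < n0" for k
      using that J0 J1 C D unfolding P_def Q_def by (intro eq_matI) auto
    then show ?thesis by auto
  qed
  also have "\<dots> \<longleftrightarrow> (\<exists>\<tau> \<in> snd ` set bs0. det (\<tau> \<cdot>\<^sub>m C - D) = 0)"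
    unfolding diag0[symmetric] by blast
  also have "(\<exists>k<n1. det (P $$ (n0 + k, n0 + k) \<cdot>\<^sub>m C - Q $$ (n0 + k, n0 + k) \<cdot>\<^sub>m D) = 0)
      \<longleftrightarrow> n1 \<noteq> 0 \<and> det C = 0"
  proof -
    have "P $$ (n0 + k, n0 + k) \<cdot>\<^sub>m C - Q $$ (n0 + k, n0 + k) \<cdot>\<^sub>m D = C" if "k < n1" for k
      using that J0 J1 C D diag1[of k] unfolding P_def Q_def by (intro eq_matI) auto
    then have "(\<exists>k<n1. det (P $$ (n0 + k, n0 + k) \<cdot>\<^sub>m C - Q $$ (n0 + k, n0 + k) \<cdot>\<^sub>m D) = 0)
        \<longleftrightarrow> (\<exists>k<n1. det C = 0)"
      by (metis (no_types, lifting))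
    then show ?thesis by auto
  qed
  finally show ?thesis unfolding n1_def .
qed

section \<open>Spectra of error propagators\<close>

text \<open>
  Multiplying \<open>(I - Bt\<^sup>-\<^sup>1 B) - c I\<close> from the left by the nonsingular \<open>Bt\<close> gives \<open>(1 - c) Bt - B\<close>.
\<close>
lemma spectrum_error_propagator:
  assumes inv: "invertible_mat Bt" and Bt: "Bt \<in> carrier_mat n n" and B: "B \<in> carrier_mat n n"
  shows "spectrum (error_propagator Bt B) = {c. det ((1 - c) \<cdot>\<^sub>m Bt - B) = 0}"
proof -
  have nz: "det Bt \<noteq> 0" by (rule invertible_mat_det_nonzero[OF inv Bt])
  have "mat_inverse Bt \<noteq> None"
    using mat_inverse(1)[OF Bt, of "()"] det_non_zero_imp_unit[OF Bt nz, of "()"] by blast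
  then obtain W where W: "mat_inverse Bt = Some W" by auto
  note W' = mat_inverse(2)[OF Bt W]
  let ?M = "error_propagator Bt B"
  have M_eq: "?M = 1\<^sub>m n - W * B" using W B by (simp add: error_propagator_def)
  then have M: "?M \<in> carrier_mat n n" using W' B by auto
  have det_iff: "det (char_matrix ?M c) = 0 \<longleftrightarrow> det ((1 - c) \<cdot>\<^sub>m Bt - B) = 0" for c
  proof -
    have "char_matrix ?M c = (1 - c) \<cdot>\<^sub>m 1\<^sub>m n - W * B"
      unfolding char_matrix_def M_eq by (rule eq_matI) (use W' B in \<open>auto simp: algebra_simps\<close>)
    also have "Bt * \<dots> = (1 - c) \<cdot>\<^sub>m Bt - B"
    proof -
      have "Bt * ((1 - c) \<cdot>\<^sub>m 1\<^sub>m n - W * B) = Bt * ((1 - c) \<cdot>\<^sub>m 1\<^sub>m n) - Bt * (W * B)"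
        by (rule mult_minus_distrib_mat) (use W' B Bt in auto)
      also have "Bt * ((1 - c) \<cdot>\<^sub>m 1\<^sub>m n) = (1 - c) \<cdot>\<^sub>m Bt"
        using Bt by (simp add: mult_smult_distrib[OF Bt one_carrier_mat])
      also have "Bt * (W * B) = B"
        using assoc_mult_mat[of Bt n n W n B n] W' B Bt by simp
      finally show ?thesis .
    qed
    finally have "det Bt * det (char_matrix ?M c) = det ((1 - c) \<cdot>\<^sub>m Bt - B)"
      by (simp only: det_mult[OF Bt char_matrix_closed[OF M], symmetric])
    with nz show ?thesis by (metis mult_eq_0_iff)
  qed
  show ?thesis
    by (rule Set.set_eqI) (simp only: spectrum_def mem_Collect_eq eigenvalue_det[OF M] det_iff)
qed

lemma cf_matrix_carrier:
  assumes "T0 \<in> carrier_mat N N" and "T1 \<in> carrier_mat N N" and "B \<in> carrier_mat m m"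
  shows "cf_matrix T0 T1 B \<in> carrier_mat (N * m) (N * m)"
  unfolding cf_matrix_def using assms
  by (intro minus_carrier_mat kronecker_prod_carrier) auto

text \<open>
  The CF-matrix is affine in its argument with constant term \<open>T0 \<otimes> I\<close>, so the coefficients
  \<open>1 - c\<close> and \<open>- 1\<close> add up to \<open>- c\<close> there.
\<close>
lemma cf_matrix_combination:
  assumes T0: "T0 \<in> carrier_mat N N" and T1: "T1 \<in> carrier_mat N N"
    and A: "A \<in> carrier_mat m m" and At: "At \<in> carrier_mat m m"
  shows "(1 - c) \<cdot>\<^sub>m cf_matrix T0 T1 At - cf_matrix T0 T1 A
    = T0 \<otimes>\<^sub>K ((- c) \<cdot>\<^sub>m 1\<^sub>m m) - T1 \<otimes>\<^sub>K ((1 - c) \<cdot>\<^sub>m At - A)" (is "?L = ?R")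
proof (rule eq_matI)
  let ?D = "(1 - c) \<cdot>\<^sub>m At - A"
  have D: "?D \<in> carrier_mat m m" and C: "(- c) \<cdot>\<^sub>m 1\<^sub>m m \<in> carrier_mat m m" and I: "1\<^sub>m m \<in> carrier_mat m m"
    using A At by auto
  have dim: "dim_row (T1 \<otimes>\<^sub>K B) = N * m" "dim_col (T1 \<otimes>\<^sub>K B) = N * m"
      "dim_row (T0 \<otimes>\<^sub>K B) = N * m" "dim_col (T0 \<otimes>\<^sub>K B) = N * m"
    if "B \<in> carrier_mat m m" for B
    using T0 T1 that by (auto simp: kronecker_prod_def)
  have dims: "dim_row A = m" "dim_row At = m" "dim_col A = m" "dim_col At = m"
    using A At by auto
  show "dim_row ?L = dim_row ?R" "dim_col ?L = dim_col ?R"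
    using dim[OF D] dim[OF A] dim[OF At] by (simp_all add: cf_matrix_def)
  fix i j
  assume "i < dim_row ?R" "j < dim_col ?R"
  then have i: "i < N * m" and j: "j < N * m" using dim[OF D] by simp_all
  note ij = i j div_mod_less_mult[OF i] div_mod_less_mult[OF j]
  show "?L $$ (i, j) = ?R $$ (i, j)"
    using ij
    by (simp add: cf_matrix_def dims dim[OF D] dim[OF A] dim[OF At] dim[OF C] dim[OF I]
        kronecker_prod_index[OF T1 A] kronecker_prod_index[OF T1 At] kronecker_prod_index[OF T1 D]
        kronecker_prod_index[OF T0 I] kronecker_prod_index[OF T0 C] algebra_simps)
qed

theorem theorem4p7:
  fixes n m :: nat
    and T0 T1 U V A At :: "complex mat"
    and bs0 :: "(nat \<times> complex) list" and bs1 :: "nat list"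
  assumes "m \<ge> 1"
    and "T0 \<in> carrier_mat (n + 1) (n + 1)" and "T1 \<in> carrier_mat (n + 1) (n + 1)"
    and "tridiagonal_mat T0" and "tridiagonal_mat T1"
    and "regular_pencil T0 T1"
    and "weierstrass_form (n + 1) T0 T1 U V bs0 bs1"
    and "A \<in> carrier_mat m m" and "At \<in> carrier_mat m m"
    and "invertible_mat (cf_matrix T0 T1 At)"
    and "\<forall>\<tau> \<in> snd ` set bs0. invertible_mat (At - \<tau> \<cdot>\<^sub>m 1\<^sub>m m)"
  defines "M \<equiv> \<lambda>\<tau>. error_propagator (At - \<tau> \<cdot>\<^sub>m 1\<^sub>m m) (A - \<tau> \<cdot>\<^sub>m 1\<^sub>m m)"
    and "MT \<equiv> error_propagator (cf_matrix T0 T1 At) (cf_matrix T0 T1 A)"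
  shows "spectrum MT =
    (if sum_list bs1 = 0 then \<Union>\<tau> \<in> snd ` set bs0. spectrum (M \<tau>)
     else (\<Union>\<tau> \<in> snd ` set bs0. spectrum (M \<tau>)) \<union> {0})"
proof -
  note T0 = assms(2) and T1 = assms(3) and A = assms(8) and At = assms(9)
  have shifted: "c \<in> spectrum (M \<tau>) \<longleftrightarrow> det (\<tau> \<cdot>\<^sub>m ((- c) \<cdot>\<^sub>m 1\<^sub>m m) - ((1 - c) \<cdot>\<^sub>m At - A)) = 0"
    if "\<tau> \<in> snd ` set bs0" for c \<tau>
  proof -
    have "spectrum (M \<tau>) = {c. det ((1 - c) \<cdot>\<^sub>m (At - \<tau> \<cdot>\<^sub>m 1\<^sub>m m) - (A - \<tau> \<cdot>\<^sub>m 1\<^sub>m m)) = 0}"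
      unfolding M_def by (rule spectrum_error_propagator) (use that assms(11) A At in auto)
    \<comment> \<open>the shifts cancel since \<open>- \<tau> c = (1 - c) \<tau> - \<tau>\<close>\<close>
    moreover have "\<tau> \<cdot>\<^sub>m ((- c) \<cdot>\<^sub>m 1\<^sub>m m) - ((1 - c) \<cdot>\<^sub>m At - A)
        = (-1) \<cdot>\<^sub>m ((1 - c) \<cdot>\<^sub>m (At - \<tau> \<cdot>\<^sub>m 1\<^sub>m m) - (A - \<tau> \<cdot>\<^sub>m 1\<^sub>m m))"
      by (rule eq_matI) (use A At in \<open>auto simp: algebra_simps\<close>)
    ultimately show ?thesis by simp
  qed
  have "c \<in> spectrum MT \<longleftrightarrow>
    (\<exists>\<tau> \<in> snd ` set bs0. c \<in> spectrum (M \<tau>)) \<or> (sum_list bs1 \<noteq> 0 \<and> c = 0)" for c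
  proof -
    have "c \<in> spectrum MT \<longleftrightarrow> det ((1 - c) \<cdot>\<^sub>m cf_matrix T0 T1 At - cf_matrix T0 T1 A) = 0"
      unfolding MT_def
      using spectrum_error_propagator[OF assms(10) cf_matrix_carrier[OF T0 T1 At] cf_matrix_carrier[OF T0 T1 A]]
      by simp
    also have "\<dots> \<longleftrightarrow> (\<exists>\<tau> \<in> snd ` set bs0. det (\<tau> \<cdot>\<^sub>m ((- c) \<cdot>\<^sub>m 1\<^sub>m m) - ((1 - c) \<cdot>\<^sub>m At - A)) = 0)
        \<or> (sum_list bs1 \<noteq> 0 \<and> det ((- c) \<cdot>\<^sub>m 1\<^sub>m m :: complex mat) = 0)"
      unfolding cf_matrix_combination[OF T0 T1 A At]
      by (rule det_kronecker_weierstrass[OF assms(7) T0 T1]) (use A At in auto)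
    \<comment> \<open>for \<open>m = 0\<close> the determinant would be 1 and every spectrum empty\<close>
    also have "det ((- c) \<cdot>\<^sub>m 1\<^sub>m m :: complex mat) = 0 \<longleftrightarrow> c = 0"
      using \<open>m \<ge> 1\<close> by simp
    finally show ?thesis using shifted by auto
  qed
  then show ?thesis by auto
qed

end
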